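(* Let $(t_k)$ be a sequence of positive reals decreasing to $0$, let $\mathcal{R}\in\{S,LF,KDB,SU,KS\}$, let $(r^k)$ be a real sequence and $\bar r>0$ with $r^k>\bar r>0$ for all $k$, and let $(x^k)\subset X$ be such that, for every $k$, $x^k$ is an optimal solution of the relaxed problem on $X\cap B(x^k,r^k)$, i.e. $\psi^{t_k}_{\mathcal{R}}(x^k)\le\psi^{t_k}_{\mathcal{R}}(x)$ for all $x\in X\cap B(x^k,r^k)$. Then a point $\bar x$ is a local optimal solution of $\min_{x\in X}\psi_p(x)$ provided that $x^k\to\bar x$ as $k\to\infty$ and one of the following conditions holds: (a) $\mathcal{R}\in\{S,LF,SU,KS\}$, the function $x\mapsto\psi_p(x)$ is lower semicontinuous at $\bar x$, and for every $x\in\mathbb{R}^n$ the function $t\mapsto\psi^t_{\mathcal{R}}(x)$ is upper semicontinuous at $0^+$. (b) $\mathcal{R}=KDB$ and, for every $x\in\mathbb{R}^n$, the function $(t,u)\mapsto\psi^t_{\mathcal{R}}(u)$ is lower semicontinuous at $(0^+,x)$ and the function $t\mapsto\psi^t_{\mathcal{R}}(x)$ is upper semicontinuous at $0^+$.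
   Context: Problem data. $F,f:\mathbb{R}^n\times\mathbb{R}^m\to\mathbb{R}$, $G:\mathbb{R}^n\to\mathbb{R}^p$, $g:\mathbb{R}^n\times\mathbb{R}^m\to\mathbb{R}^q$; $F,G$ are twice and $f,g$ thrice continuously differentiable. $X=\{x\in\mathbb{R}^n: G(x)\le 0\}$. For every $x\in X$: the lower-level problem $\min_y\{f(x,y): g(x,y)\le 0\}$ has at least one solution; $f(x,\cdot)$ and all $g_i(x,\cdot)$ are convex; there is $y(x)\in\mathbb{R}^m$ with $g_i(x,y(x))<0$ for all $i=1,\dots,q$. Put $\mathcal{L}(x,y,u)=\nabla_y f(x,y)+\sum_{i=1}^q u_i\nabla_y g_i(x,y)\in\mathbb{R}^m$, and $$\mathcal{D}(x)=\{(y,u)\in\mathbb{R}^{m+q}: \mathcal{L}(x,y,u)=0,\ u\ge 0,\ g(x,y)\le 0,\ u^\top g(x,y)=0\}.$$ Relaxations. For $t>0$ and $\mathcal{R}\in\{S,LF,KDB,SU,KS\}$ (Scholtes; Lin–Fukushima; Kadrani–Dussault–Benchakroun; Steffensen–Ulbrich; Kanzow–Schwartz), $\mathcal{D}^t_{\mathcal{R}}(x)$ is the set of $(y,u)\in\mathbb{R}^{m+q}$ with $\mathcal{L}(x,y,u)=0$ and, for all $i=1,\dots,q$ (writing $g_i=g_i(x,y)$): - $S$: $g_i\le 0$, $-u_i\le 0$, $-u_ig_i-t\le 0$; - $LF$: $-(u_ig_i+t^2)\le 0$, $-(u_i+t)(-g_i+t)+t^2\le 0$; - $KDB$: $g_i-t\le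 0$, $-u_i-t\le 0$, $-(u_i-t)(g_i+t)\le 0$; - $SU$: $g_i\le 0$, $-u_i\le 0$, $\varphi^t_{i,SU}(x,y,u)\le 0$; - $KS$: $g_i\le 0$, $-u_i\le 0$, $\varphi^t_{i,KS}(x,y,u)\le 0$. Here $\varphi^t_{i,SU}=2u_i$ if $g_i+u_i\le -t$; $\varphi^t_{i,SU}=-2g_i$ if $g_i+u_i\ge t$; $\varphi^t_{i,SU}=u_i-g_i-t\,\vartheta\big(\frac{u_i+g_i}{t}\big)$ if $|u_i+g_i|<t$, where $\vartheta:[-1,1]\to\mathbb{R}$ is a fixed regularization function: $\vartheta$ is $C^2$ on $[-1,1]$, $\vartheta(\pm1)=1$, $\vartheta'(-1)=-1$, $\vartheta'(1)=1$, $\vartheta''(\pm1)=0$, $\vartheta''>0$ on $(-1,1)$. And $\varphi^t_{i,KS}=(u_i-t)(-g_i-t)$ if $u_i-g_i\ge 2t$; $\varphi^t_{i,KS}=-\frac12\big((u_i-t)^2+(-g_i-t)^2\big)$ if $u_i-g_i<2t$. It is assumed throughout that $\mathcal{D}^t_{\mathcal{R}}(x)\neq\emptyset$ for all $t>0$, $x\in\mathbb{R}^n$ and all $\mathcal{R}$. Value functions: $\psi_p(x)=\max_{(y,u)\in\mathcal{D}(x)}F(x,y)$ and $\psi^t_{\mathcal{R}}(x)=\max_{(y,u)\in\mathcal{D}^t_{\mathcal{R}}(x)}F(x,y)$ (optimal values, i.e. suprema in the extended reals if not attained). $B(x,r)$ is the ball of center $x$ and radius $r$. Local optimal solution of $\min_{x\in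 X}\psi(x)$: a point $\bar x\in X$ such that, for some neighborhood $U$ of $\bar x$, $\psi(\bar x)\le\psi(x)$ for all $x\in X\cap U$. Semicontinuity at $0^+$ uses the convention $\psi^0_{\mathcal{R}}:=\psi_p$: $t\mapsto\psi^t_{\mathcal{R}}(x)$ is upper semicontinuous at $0^+$ if $\limsup_{t\downarrow 0}\psi^t_{\mathcal{R}}(x)\le\psi_p(x)$; $(t,u)\mapsto\psi^t_{\mathcal{R}}(u)$ is lower semicontinuous at $(0^+,x)$ if $\liminf_{t\downarrow 0,\,u\to x}\psi^t_{\mathcal{R}}(u)\ge\psi_p(x)$. *)

theory Defs
  imports "HOL-Analysis.Analysis"
begin

(* On a finite-dimensional domain, f is C^(k+1) iff it is differentiable and every
   directional derivative x |-> Df(x) v is C^k. *)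
fun Ck :: "nat \<Rightarrow> ('a::euclidean_space \<Rightarrow> 'b::real_normed_vector) \<Rightarrow> bool" where
  "Ck 0 f \<longleftrightarrow> continuous_on UNIV f"
| "Ck (Suc k) f \<longleftrightarrow> (\<forall>x. f differentiable (at x)) \<and>
     (\<forall>v. Ck k (\<lambda>x. frechet_derivative f (at x) v))"

definition gradient :: "('a::euclidean_space \<Rightarrow> real) \<Rightarrow> 'a \<Rightarrow> 'a" where
  "gradient h y = (THE D. GDERIV h y :> D)"

definition grad_lagrangian ::
  "(real^'n \<Rightarrow> real^'m \<Rightarrow> real) \<Rightarrow> (real^'n \<Rightarrow> real^'m \<Rightarrow> real^'q)
    \<Rightarrow> real^'n \<Rightarrow> real^'m \<Rightarrow> real^'q \<Rightarrow> real^'m" where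
  "grad_lagrangian f g x y u =
     gradient (f x) y + (\<Sum>i\<in>UNIV. (u $ i) *\<^sub>R gradient (\<lambda>y'. g x y' $ i) y)"

(* The order on real^'q is the componentwise one. *)
definition kkt_set ::
  "(real^'n \<Rightarrow> real^'m \<Rightarrow> real) \<Rightarrow> (real^'n \<Rightarrow> real^'m \<Rightarrow> real^'q)
    \<Rightarrow> real^'n \<Rightarrow> ((real^'m) \<times> (real^'q)) set" where
  "kkt_set f g x =
     {(y, u). grad_lagrangian f g x y u = 0 \<and> 0 \<le> u \<and> g x y \<le> 0 \<and> u \<bullet> g x y = 0}"

(* The derivatives at the end points of [-1,1] are one-sided. *)
definition regularization_function :: "(real \<Rightarrow> real) \<Rightarrow> bool" where
  "regularization_function \<theta> \<longleftrightarrow>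
     (\<exists>\<theta>' \<theta>''.
        (\<forall>s\<in>{-1..1}. (\<theta> has_real_derivative \<theta>' s) (at s within {-1..1})) \<and>
        (\<forall>s\<in>{-1..1}. (\<theta>' has_real_derivative \<theta>'' s) (at s within {-1..1})) \<and>
        continuous_on {-1..1} \<theta>'' \<and>
        \<theta> (-1) = 1 \<and> \<theta> 1 = 1 \<and> \<theta>' (-1) = -1 \<and> \<theta>' 1 = 1 \<and>
        \<theta>'' (-1) = 0 \<and> \<theta>'' 1 = 0 \<and> (\<forall>s\<in>{-1<..<1}. \<theta>'' s > 0))"

datatype relaxation =
    Scholtes | Lin_Fukushima | Kadrani_Dussault_Benchakroun | Steffensen_Ulbrich | Kanzow_Schwartz

(* In phi_SU, phi_KS and relaxed_compl, the real arguments a and u stand for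
   g_i(x,y) and the multiplier u_i of that constraint. *)
definition phi_SU :: "(real \<Rightarrow> real) \<Rightarrow> real \<Rightarrow> real \<Rightarrow> real \<Rightarrow> real" where
  "phi_SU \<theta> t a u =
     (if a + u \<le> - t then 2 * u
      else if a + u \<ge> t then - 2 * a
      else u - a - t * \<theta> ((u + a) / t))"

definition phi_KS :: "real \<Rightarrow> real \<Rightarrow> real \<Rightarrow> real" where
  "phi_KS t a u =
     (if u - a \<ge> 2 * t then (u - t) * (- a - t)
      else - (1/2) * ((u - t)\<^sup>2 + (- a - t)\<^sup>2))"

fun relaxed_compl :: "(real \<Rightarrow> real) \<Rightarrow> relaxation \<Rightarrow> real \<Rightarrow> real \<Rightarrow> real \<Rightarrow> bool" where
  "relaxed_compl \<theta> Scholtes t a u \<longleftrightarrow> a \<le> 0 \<and> - u \<le> 0 \<and> - u * a - t \<le> 0"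
| "relaxed_compl \<theta> Lin_Fukushima t a u \<longleftrightarrow>
     - (u * a + t\<^sup>2) \<le> 0 \<and> - (u + t) * (- a + t) + t\<^sup>2 \<le> 0"
| "relaxed_compl \<theta> Kadrani_Dussault_Benchakroun t a u \<longleftrightarrow>
     a - t \<le> 0 \<and> - u - t \<le> 0 \<and> - (u - t) * (a + t) \<le> 0"
| "relaxed_compl \<theta> Steffensen_Ulbrich t a u \<longleftrightarrow> a \<le> 0 \<and> - u \<le> 0 \<and> phi_SU \<theta> t a u \<le> 0"
| "relaxed_compl \<theta> Kanzow_Schwartz t a u \<longleftrightarrow> a \<le> 0 \<and> - u \<le> 0 \<and> phi_KS t a u \<le> 0"

definition relaxed_kkt_set ::
  "(real \<Rightarrow> real) \<Rightarrow> (real^'n \<Rightarrow> real^'m \<Rightarrow> real) \<Rightarrow> (real^'n \<Rightarrow> real^'m \<Rightarrow> real^'q)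
    \<Rightarrow> relaxation \<Rightarrow> real \<Rightarrow> real^'n \<Rightarrow> ((real^'m) \<times> (real^'q)) set" where
  "relaxed_kkt_set \<theta> f g R t x =
     {(y, u). grad_lagrangian f g x y u = 0 \<and> (\<forall>i. relaxed_compl \<theta> R t (g x y $ i) (u $ i))}"

(* Optimal values are suprema in the extended reals; over an empty feasible set the value is -\<infinity>. *)
definition psi_p ::
  "(real^'n \<Rightarrow> real^'m \<Rightarrow> real) \<Rightarrow> (real^'n \<Rightarrow> real^'m \<Rightarrow> real)
    \<Rightarrow> (real^'n \<Rightarrow> real^'m \<Rightarrow> real^'q) \<Rightarrow> real^'n \<Rightarrow> ereal" where
  "psi_p F f g x = (SUP (y, u)\<in>kkt_set f g x. ereal (F x y))"

definition psi_relaxed ::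
  "(real \<Rightarrow> real) \<Rightarrow> (real^'n \<Rightarrow> real^'m \<Rightarrow> real) \<Rightarrow> (real^'n \<Rightarrow> real^'m \<Rightarrow> real)
    \<Rightarrow> (real^'n \<Rightarrow> real^'m \<Rightarrow> real^'q) \<Rightarrow> relaxation \<Rightarrow> real \<Rightarrow> real^'n \<Rightarrow> ereal" where
  "psi_relaxed \<theta> F f g R t x = (SUP (y, u)\<in>relaxed_kkt_set \<theta> f g R t x. ereal (F x y))"

definition local_optimal_solution ::
  "'a::topological_space set \<Rightarrow> ('a \<Rightarrow> ereal) \<Rightarrow> 'a \<Rightarrow> bool" where
  "local_optimal_solution X \<psi> x0 \<longleftrightarrow>
     x0 \<in> X \<and> (\<exists>U. open U \<and> x0 \<in> U \<and> (\<forall>x\<in>X \<inter> U. \<psi> x0 \<le> \<psi> x))"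

definition lsc_at :: "('a::topological_space \<Rightarrow> ereal) \<Rightarrow> 'a \<Rightarrow> bool" where
  "lsc_at \<psi> x \<longleftrightarrow> \<psi> x \<le> Liminf (nhds x) \<psi>"

(* Semicontinuity at t = 0+ of a family \<Psi> t with \<psi>0 as its value at t = 0: only t > 0
   enters the limits, and in lsc_at_0_plus the points u -> x may equal x. *)
definition usc_at_0_plus :: "('a \<Rightarrow> ereal) \<Rightarrow> (real \<Rightarrow> 'a \<Rightarrow> ereal) \<Rightarrow> 'a \<Rightarrow> bool" where
  "usc_at_0_plus \<psi>0 \<Psi> x \<longleftrightarrow> Limsup (at_right 0) (\<lambda>t. \<Psi> t x) \<le> \<psi>0 x"

definition lsc_at_0_plus ::
  "('a::topological_space \<Rightarrow> ereal) \<Rightarrow> (real \<Rightarrow> 'a \<Rightarrow> ereal) \<Rightarrow> 'a \<Rightarrow> bool" where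
  "lsc_at_0_plus \<psi>0 \<Psi> x \<longleftrightarrow> \<psi>0 x \<le> Liminf (at_right 0 \<times>\<^sub>F nhds x) (\<lambda>(t, u). \<Psi> t u)"

end

theory Submission
  imports Defs
begin

text \<open>
  The local optimality of the limit comes from passing to the limit in
  \<open>\<psi>\<^sup>t (x\<^sup>k) \<le> \<psi>\<^sup>t (x)\<close> (with \<open>t = t\<^sub>k\<close>) for each fixed feasible \<open>x\<close> near \<open>xbar\<close>.
  The lower bound \<open>rbar\<close> on the radii makes this inequality available for all large \<open>k\<close> as
  soon as \<open>x\<close> lies within \<open>rbar / 2\<close> of \<open>xbar\<close>, so the neighbourhood does not shrink with \<open>k\<close>.
  Upper semicontinuity in \<open>t\<close> bounds the upper limit of the right-hand side by \<open>\<psi>\<^sub>p x\<close>, and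
  what remains is to bound the lower limit of the left-hand side from below by \<open>\<psi>\<^sub>p xbar\<close>.

  For the Kadrani--Dussault--Benchakroun relaxation this bound is the joint lower semicontinuity
  hypothesis. The other four schemes really are relaxations: a complementary pair
  \<open>a \<le> 0 \<le> u\<close>, \<open>u * a = 0\<close> satisfies each of their conditions
  (lemma \<open>relaxed_compl_of_complementary\<close>), so \<open>\<psi>\<^sub>p \<le> \<psi>\<^sup>t\<close> pointwise and lower
  semicontinuity of \<open>\<psi>\<^sub>p\<close> alone is enough. The pair \<open>a = u = 0\<close> violates the
  Kadrani--Dussault--Benchakroun condition, which is why that scheme is treated apart.
\<close>

text \<open>
  A regularization function is convex and its tangents at the two end points are \<open>s\<close> and
  \<open>- s\<close>, so it lies above both. The derivative is nondecreasing and hence stays in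
  \<open>{-1..1}\<close>; integrating this from \<open>1\<close> backwards gives the bound by \<open>s\<close>, from \<open>-1\<close> forwards the
  bound by \<open>- s\<close>.
\<close>
lemma regularization_function_ge_abs:
  assumes "regularization_function \<theta>" and s: "s \<in> {-1..1}"
  shows "\<bar>s\<bar> \<le> \<theta> s"
proof -
  obtain \<theta>' \<theta>'' where
    d1: "\<And>s. s \<in> {-1..1} \<Longrightarrow> (\<theta> has_real_derivative \<theta>' s) (at s within {-1..1})" and
    d2: "\<And>s. s \<in> {-1..1} \<Longrightarrow> (\<theta>' has_real_derivative \<theta>'' s) (at s within {-1..1})" and
    ends: "\<theta> (-1) = 1" "\<theta> 1 = 1" "\<theta>' (-1) = -1" "\<theta>' 1 = 1" and
    pos: "\<And>s. s \<in> {-1<..<1} \<Longrightarrow> \<theta>'' s > 0"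
    using assms(1) unfolding regularization_function_def by blast
  have interior: "at x within {-1..1} = at x" if "-1 < x" "x < 1" for x :: real
    using that by (simp add: at_within_Icc_at)
  have cont: "continuous_on {-1..1} \<theta>" "continuous_on {-1..1} \<theta>'"
    by (rule DERIV_continuous_on, erule d1, rule DERIV_continuous_on, erule d2)
  have mono: "\<theta>' a \<le> \<theta>' b" if "-1 \<le> a" "a \<le> b" "b \<le> 1" for a b
  proof (rule DERIV_nonneg_imp_increasing_open[OF \<open>a \<le> b\<close>])
    show "\<exists>y. (\<theta>' has_real_derivative y) (at x) \<and> 0 \<le> y" if "a < x" "x < b" for x
      using d2[of x] pos[of x] interior[of x] that \<open>-1 \<le> a\<close> \<open>b \<le> 1\<close>
      by (intro exI[of _ "\<theta>'' x"]) (auto intro: less_imp_le)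
    show "continuous_on {a..b} \<theta>'"
      using cont(2) that by (auto intro: continuous_on_subset)
  qed
  have deriv: "(\<theta> has_real_derivative \<theta>' x) (at x)" "-1 \<le> \<theta>' x" "\<theta>' x \<le> 1"
    if "-1 < x" "x < 1" for x
    using d1[of x] interior[of x] that mono[of "-1" x] mono[of x 1] ends by auto
  have "s - \<theta> s \<le> 1 - \<theta> 1"
  proof (rule DERIV_nonneg_imp_increasing_open[where f = "\<lambda>x. x - \<theta> x"])
    show "\<exists>y. ((\<lambda>x. x - \<theta> x) has_real_derivative y) (at x) \<and> 0 \<le> y" if "s < x" "x < 1" for x
      using deriv[of x] that s
      by (intro exI[of _ "1 - \<theta>' x"]) (auto intro!: derivative_eq_intros)
    show "continuous_on {s..1} (\<lambda>x. x - \<theta> x)"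
      using s by (auto intro!: continuous_intros continuous_on_subset[OF cont(1)])
  qed (use s in auto)
  moreover have "- 1 + \<theta> (-1) \<le> s + \<theta> s"
  proof (rule DERIV_nonneg_imp_increasing_open[where f = "\<lambda>x. x + \<theta> x"])
    show "\<exists>y. ((\<lambda>x. x + \<theta> x) has_real_derivative y) (at x) \<and> 0 \<le> y" if "-1 < x" "x < s" for x
      using deriv[of x] that s
      by (intro exI[of _ "1 + \<theta>' x"]) (auto intro!: derivative_eq_intros)
    show "continuous_on {-1..s} (\<lambda>x. x + \<theta> x)"
      using s by (auto intro!: continuous_intros continuous_on_subset[OF cont(1)])
  qed (use s in auto)
  ultimately show ?thesis using ends by auto
qed

text \<open>
  On a complementary pair \<open>u - a = \<bar>u + a\<bar>\<close>, so the middle branch of \<open>\<phi>\<close> is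
  nonpositive because \<open>t * \<theta> (z / t) \<ge> \<bar>z\<bar>\<close>: the smoothing of the absolute value
  overestimates it.
\<close>
lemma phi_SU_le_0_of_complementary:
  assumes "regularization_function \<theta>" and "t > 0" "a \<le> 0" "0 \<le> u" "u * a = 0"
  shows "phi_SU \<theta> t a u \<le> 0"
proof (cases "\<bar>u + a\<bar> < t")
  case True
  have "\<bar>(u + a) / t\<bar> \<le> \<theta> ((u + a) / t)"
    using True \<open>t > 0\<close> by (intro regularization_function_ge_abs assms(1)) (auto simp: field_simps)
  then have "\<bar>u + a\<bar> \<le> t * \<theta> ((u + a) / t)"
    using \<open>t > 0\<close> by (simp add: abs_divide field_simps)
  moreover have "u - a = \<bar>u + a\<bar>" using assms by auto
  ultimately show ?thesis using True by (auto simp: phi_SU_def)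
next
  case False
  with assms show ?thesis by (auto simp: phi_SU_def)
qed

lemma phi_KS_le_0_of_complementary:
  assumes "t > 0" "a \<le> 0" "0 \<le> u" "u * a = 0"
  shows "phi_KS t a u \<le> 0"
proof -
  have "(u - t) * (- a - t) \<le> 0" if "u - a \<ge> 2 * t"
    using assms that by (auto simp: mult_le_0_iff)
  then show ?thesis by (auto simp: phi_KS_def)
qed

lemma relaxed_compl_of_complementary:
  assumes "regularization_function \<theta>" and "R \<noteq> Kadrani_Dussault_Benchakroun"
    and "t > 0" "a \<le> 0" "0 \<le> u" "u * a = 0"
  shows "relaxed_compl \<theta> R t a u"
proof (cases R)
  case Lin_Fukushima
  have "- (u + t) * (- a + t) + t\<^sup>2 = t * (a - u)"
    using \<open>u * a = 0\<close> by (simp add: algebra_simps power2_eq_square)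
  also have "\<dots> \<le> 0" using assms by (simp add: mult_le_0_iff)
  finally show ?thesis using Lin_Fukushima \<open>u * a = 0\<close> by auto
qed (use assms phi_SU_le_0_of_complementary phi_KS_le_0_of_complementary in auto)

lemma kkt_set_subset_relaxed_kkt_set:
  assumes "regularization_function \<theta>" and "R \<noteq> Kadrani_Dussault_Benchakroun" and "t > 0"
  shows "kkt_set f g x \<subseteq> relaxed_kkt_set \<theta> f g R t x"
proof (clarify)
  fix y u assume "(y, u) \<in> kkt_set f g x"
  then have L: "grad_lagrangian f g x y u = 0" and u: "\<And>i. 0 \<le> u $ i" and g: "\<And>i. g x y $ i \<le> 0"
    and sum0: "(\<Sum>i\<in>UNIV. u $ i * g x y $ i) = 0"
    by (auto simp: kkt_set_def less_eq_vec_def inner_vec_def)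
  \<comment> \<open>All summands of the inner product have the same sign, so each one vanishes.\<close>
  have "(\<Sum>i\<in>UNIV. - (u $ i * g x y $ i)) = 0"
    using sum0 by (simp add: sum_negf del: mult_eq_0_iff)
  then have "u $ i * g x y $ i = 0" for i
    using u g sum_nonneg_eq_0_iff[of UNIV "\<lambda>i. - (u $ i * g x y $ i)"]
    by (simp add: mult_nonneg_nonpos del: mult_eq_0_iff)
  then show "(y, u) \<in> relaxed_kkt_set \<theta> f g R t x"
    using L u g assms by (auto simp: relaxed_kkt_set_def intro: relaxed_compl_of_complementary)
qed

lemma psi_p_le_psi_relaxed:
  assumes "regularization_function \<theta>" and "R \<noteq> Kadrani_Dussault_Benchakroun" and "t > 0"
  shows "psi_p F f g x \<le> psi_relaxed \<theta> F f g R t x"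
  unfolding psi_p_def psi_relaxed_def
  using kkt_set_subset_relaxed_kkt_set[OF assms] by (rule SUP_subset_mono) simp

lemma Liminf_le_Liminf_compose:
  fixes \<psi> :: "'a \<Rightarrow> 'b::complete_lattice"
  assumes "filterlim h F G"
  shows "Liminf F \<psi> \<le> Liminf G (\<lambda>k. \<psi> (h k))"
  unfolding Liminf_def
proof (rule SUP_mono)
  fix P assume "P \<in> {P. eventually P F}"
  then have "eventually (\<lambda>k. P (h k)) G"
    using assms by (simp add: filterlim_iff)
  then show "\<exists>Q\<in>{P. eventually P G}. Inf (\<psi> ` Collect P) \<le> (INF k\<in>Collect Q. \<psi> (h k))"
    by (intro bexI[of _ "\<lambda>k. P (h k)"] INF_greatest INF_lower) auto
qed

lemma Limsup_compose_le_Limsup: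
  fixes \<psi> :: "'a \<Rightarrow> ereal"
  assumes "filterlim h F G"
  shows "Limsup G (\<lambda>k. \<psi> (h k)) \<le> Limsup F \<psi>"
  using Liminf_le_Liminf_compose[OF assms, of "\<lambda>x. - \<psi> x"]
  by (simp add: ereal_Liminf_uminus)

text \<open>
  The part of the argument that is common to all schemes: \<open>\<Psi> (t k)\<close> plays the relaxed value
  function and \<open>\<psi>0\<close> the limiting one, about which only the two limit estimates matter.
\<close>
lemma local_optimal_solution_of_relaxed_minimizers:
  fixes X :: "'a::metric_space set" and \<Psi> :: "real \<Rightarrow> 'a \<Rightarrow> ereal"
  assumes "closed X" and t: "filterlim t (at_right 0) sequentially"
    and "rbar > 0" and r: "\<And>k. r k > rbar"
    and xs_in: "\<And>k. xs k \<in> X" and lim: "xs \<longlonglongrightarrow> xbar"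
    and opt: "\<And>k x. x \<in> X \<inter> ball (xs k) (r k) \<Longrightarrow> \<Psi> (t k) (xs k) \<le> \<Psi> (t k) x"
    and lower: "\<psi>0 xbar \<le> liminf (\<lambda>k. \<Psi> (t k) (xs k))"
    and upper: "\<And>x. usc_at_0_plus \<psi>0 \<Psi> x"
  shows "local_optimal_solution X \<psi>0 xbar"
proof -
  have "xbar \<in> X"
    using \<open>closed X\<close> xs_in lim by (rule closed_sequentially)
  moreover have "\<psi>0 xbar \<le> \<psi>0 x" if x: "x \<in> X \<inter> ball xbar (rbar / 2)" for x
  proof -
    have "\<forall>\<^sub>F k in sequentially. dist (xs k) xbar < rbar / 2"
      using lim \<open>rbar > 0\<close> by (intro tendstoD) auto
    then have ev: "\<forall>\<^sub>F k in sequentially. \<Psi> (t k) (xs k) \<le> \<Psi> (t k) x"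
    proof eventually_elim
      case (elim k)
      have "dist (xs k) x < r k"
        using elim x r[of k] dist_triangle[of "xs k" x xbar] by auto
      then show ?case using x by (intro opt) auto
    qed
    note lower
    also have "liminf (\<lambda>k. \<Psi> (t k) (xs k)) \<le> liminf (\<lambda>k. \<Psi> (t k) x)"
      using ev by (rule Liminf_mono)
    also have "\<dots> \<le> limsup (\<lambda>k. \<Psi> (t k) x)"
      by (rule Liminf_le_Limsup) simp
    also have "\<dots> \<le> Limsup (at_right 0) (\<lambda>s. \<Psi> s x)"
      using t by (rule Limsup_compose_le_Limsup)
    also have "\<dots> \<le> \<psi>0 x"
      using upper by (simp add: usc_at_0_plus_def)
    finally show ?thesis .
  qed
  ultimately show ?thesis
    unfolding local_optimal_solution_def using \<open>rbar > 0\<close>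
    by (intro conjI exI[of _ "ball xbar (rbar / 2)"]) auto
qed

theorem theorem4p2:
  fixes F f :: "real^'n \<Rightarrow> real^'m \<Rightarrow> real"
    and G :: "real^'n \<Rightarrow> real^'p"
    and g :: "real^'n \<Rightarrow> real^'m \<Rightarrow> real^'q"
    and X :: "(real^'n) set"
    and \<theta> :: "real \<Rightarrow> real"
    and R :: relaxation
    and t r :: "nat \<Rightarrow> real"
    and rbar :: real
    and xs :: "nat \<Rightarrow> real^'n"
    and xbar :: "real^'n"
  assumes X_eq: "X = {x. G x \<le> 0}"
    and F_C2: "Ck 2 (\<lambda>(x, y). F x y)"
    and G_C2: "Ck 2 G"
    and f_C3: "Ck 3 (\<lambda>(x, y). f x y)"
    and g_C3: "Ck 3 (\<lambda>(x, y). g x y)"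
    and lower_solvable: "\<And>x. x \<in> X \<Longrightarrow> \<exists>y. is_arg_min (f x) (\<lambda>y. g x y \<le> 0) y"
    and f_convex: "\<And>x. x \<in> X \<Longrightarrow> convex_on UNIV (f x)"
    and g_convex: "\<And>x i. x \<in> X \<Longrightarrow> convex_on UNIV (\<lambda>y. g x y $ i)"
    and slater: "\<And>x. x \<in> X \<Longrightarrow> \<exists>y. \<forall>i. g x y $ i < 0"
    and \<theta>_regularization: "regularization_function \<theta>"
    and relaxed_nonempty: "\<And>Q s x. s > 0 \<Longrightarrow> relaxed_kkt_set \<theta> f g Q s x \<noteq> {}"
    and t_pos: "\<And>k. t k > 0"
    and t_decreasing: "decseq t"
    and t_lim: "t \<longlonglongrightarrow> 0"
    and rbar_pos: "rbar > 0"
    and r_bound: "\<And>k. r k > rbar"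
    and xs_in: "\<And>k. xs k \<in> X"
    and xs_optimal: "\<And>k x. x \<in> X \<inter> ball (xs k) (r k) \<Longrightarrow>
          psi_relaxed \<theta> F f g R (t k) (xs k) \<le> psi_relaxed \<theta> F f g R (t k) x"
    and xs_lim: "xs \<longlonglongrightarrow> xbar"
    and cond_a_or_b:
      "(R \<in> {Scholtes, Lin_Fukushima, Steffensen_Ulbrich, Kanzow_Schwartz} \<and>
          lsc_at (psi_p F f g) xbar \<and>
          (\<forall>x. usc_at_0_plus (psi_p F f g) (psi_relaxed \<theta> F f g R) x)) \<or>
       (R = Kadrani_Dussault_Benchakroun \<and>
          (\<forall>x. lsc_at_0_plus (psi_p F f g) (psi_relaxed \<theta> F f g R) x \<and>
               usc_at_0_plus (psi_p F f g) (psi_relaxed \<theta> F f g R) x))"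
  shows "local_optimal_solution X (psi_p F f g) xbar"
proof -
  have "continuous_on UNIV G"
    using G_C2 by (auto simp: numeral_2_eq_2 continuous_on_eq_continuous_at
        intro: differentiable_imp_continuous_within)
  then have "closed X"
    unfolding X_eq less_eq_vec_def
    by (auto intro!: closed_Collect_all closed_Collect_le continuous_intros)
  have t: "filterlim t (at_right 0) sequentially"
    using t_lim t_pos by (intro tendsto_imp_filterlim_at_right) auto
  have lower: "psi_p F f g xbar \<le> liminf (\<lambda>k. psi_relaxed \<theta> F f g R (t k) (xs k))"
    using cond_a_or_b
  proof (elim disjE conjE)
    assume "R \<in> {Scholtes, Lin_Fukushima, Steffensen_Ulbrich, Kanzow_Schwartz}"
      and "lsc_at (psi_p F f g) xbar"
    then have "psi_p F f g xbar \<le> Liminf (nhds xbar) (psi_p F f g)"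
      by (simp add: lsc_at_def)
    also have "\<dots> \<le> liminf (\<lambda>k. psi_p F f g (xs k))"
      using xs_lim by (rule Liminf_le_Liminf_compose)
    also have "\<dots> \<le> liminf (\<lambda>k. psi_relaxed \<theta> F f g R (t k) (xs k))"
      using \<open>R \<in> _\<close> t_pos
      by (intro Liminf_mono always_eventually allI psi_p_le_psi_relaxed \<theta>_regularization) auto
    finally show ?thesis .
  next
    assume "\<forall>x. lsc_at_0_plus (psi_p F f g) (psi_relaxed \<theta> F f g R) x \<and>
               usc_at_0_plus (psi_p F f g) (psi_relaxed \<theta> F f g R) x"
    then have "psi_p F f g xbar
        \<le> Liminf (at_right 0 \<times>\<^sub>F nhds xbar) (\<lambda>(s, x). psi_relaxed \<theta> F f g R s x)"
      by (simp add: lsc_at_0_plus_def)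
    also have "\<dots> \<le> liminf (\<lambda>k. case (t k, xs k) of (s, x) \<Rightarrow> psi_relaxed \<theta> F f g R s x)"
      using t xs_lim by (intro Liminf_le_Liminf_compose filterlim_Pair)
    finally show ?thesis by simp
  qed
  show ?thesis
    using \<open>closed X\<close> t rbar_pos r_bound xs_in xs_lim xs_optimal lower
  proof (rule local_optimal_solution_of_relaxed_minimizers)
    show "usc_at_0_plus (psi_p F f g) (psi_relaxed \<theta> F f g R) x" for x
      using cond_a_or_b by auto
  qed
qed

end
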